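(* Suppose that axioms (A1) and (A2) (stated in the context) are satisfied. Then there exists a substance $S\subseteq \bigcap_{t\in\mathbb{R}} E_t$ such that $S\neq e$ and $$\mathcal{C}(e)\subseteq \mathcal{C}(S)=S.$$ Moreover, for every $t\in\mathbb{R}$, every substance $\Lambda\subseteq E_t$ satisfies $S\subseteq\Lambda$.
   Context: Time is modelled by $\mathbb{R}$. For each $t\in\mathbb{R}$, $E_t$ is a set (everything existing or having existed before time $t$), and $E_t\subseteq E_{t'}$ whenever $t\le t'$. $\mathcal{P}(E_t)$ is the power set of $E_t$, ordered by inclusion. The law of causality is a time-independent rule $\mathcal{C}$ assigning to every $A\in\bigcup_{t\in\mathbb{R}}\mathcal{P}(E_t)$ a set $\mathcal{C}(A)$ (the cause of $A$), not depending on $t$, with $\mathcal{C}(A)\in\mathcal{P}(E_t)$ whenever $A\in\mathcal{P}(E_t)$. Axiom (A1): for every $t\in\mathbb{R}$, $\mathcal{C}$ restricts to a map $\mathcal{P}(E_t)\to\mathcal{P}(E_t)\setminus\{\emptyset\}$ (every cause is nonempty). Axiom (A2): for every $t\in\mathbb{R}$ and all $A,B\in\mathcal{P}(E_t)$, if $A\subseteq B$ then $\mathcal{C}(A)\subseteq\mathcal{C}(B)$. The set $e$ is $e:=\bigcap_{t\in\mathbb{R}}\bigcap_{A\subseteq E_t}A=\emptyset$. A substance is a set $S\subseteq E_t$, for some $t\in\mathbb{R}$, such that $\mathcal{C}(S)=S$. *)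

theory Defs
  imports Complex_Main "HOL-Library.FuncSet"
begin

text \<open>
  \<open>E t\<close> is everything existing or having existed before time \<open>t\<close>, and \<open>C\<close> is the law of causality.
  The domain of \<open>C\<close> is the union of the power sets of the \<open>E t\<close>: every condition below
  constrains \<open>C\<close> only on subsets of some \<open>E t\<close>.
\<close>

locale causal_world =
  fixes E :: "real \<Rightarrow> 'a set" and C :: "'a set \<Rightarrow> 'a set"
  assumes E_mono: "mono E"
    and C_closed: "C \<in> Pow (E t) \<rightarrow> Pow (E t)"

definition axiom_A1 :: "(real \<Rightarrow> 'a set) \<Rightarrow> ('a set \<Rightarrow> 'a set) \<Rightarrow> bool" where
  "axiom_A1 E C \<longleftrightarrow> (\<forall>t. C \<in> Pow (E t) \<rightarrow> Pow (E t) - {{}})"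

definition axiom_A2 :: "(real \<Rightarrow> 'a set) \<Rightarrow> ('a set \<Rightarrow> 'a set) \<Rightarrow> bool" where
  "axiom_A2 E C \<longleftrightarrow> (\<forall>t. \<forall>A \<in> Pow (E t). \<forall>B \<in> Pow (E t). A \<subseteq> B \<longrightarrow> C A \<subseteq> C B)"

definition e_set :: "(real \<Rightarrow> 'a set) \<Rightarrow> 'a set" where
  "e_set E = (\<Inter>t. \<Inter>A \<in> Pow (E t). A)"

lemma e_set_eq_empty: "e_set E = {}"
  unfolding e_set_def by blast

definition substance :: "(real \<Rightarrow> 'a set) \<Rightarrow> ('a set \<Rightarrow> 'a set) \<Rightarrow> 'a set \<Rightarrow> bool" where
  "substance E C S \<longleftrightarrow> (\<exists>t. S \<subseteq> E t) \<and> C S = S"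

end

theory Submission
  imports Defs
begin

text \<open>
  This is the Knaster--Tarski construction, run across all times at once. Call a set \<open>A\<close> that exists
  at some time causally closed if \<open>C A \<subseteq> A\<close>, and let \<open>S\<close> be the intersection of all causally closed
  sets. Each \<open>E t\<close> is itself causally closed, so \<open>S\<close> lies in every \<open>E t\<close>; this is what lets one set
  serve all times, because \<open>S\<close> can be compared with a closed set \<open>A\<close> inside whichever \<open>E t\<close>
  contains \<open>A\<close>. The usual argument then gives \<open>C S = S\<close>. Substances are causally closed, hence
  contain \<open>S\<close>, and \<open>S = C S\<close> is nonempty because causes are.
\<close>

definition causally_closed :: "(real \<Rightarrow> 'a set) \<Rightarrow> ('a set \<Rightarrow> 'a set) \<Rightarrow> 'a set \<Rightarrow> bool" where
  "causally_closed E C A \<longleftrightarrow> (\<exists>t. A \<subseteq> E t) \<and> C A \<subseteq> A"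

definition least_closed :: "(real \<Rightarrow> 'a set) \<Rightarrow> ('a set \<Rightarrow> 'a set) \<Rightarrow> 'a set" where
  "least_closed E C = \<Inter>{A. causally_closed E C A}"

lemma least_closed_lower: "causally_closed E C A \<Longrightarrow> least_closed E C \<subseteq> A"
  unfolding least_closed_def by blast

lemma substance_imp_causally_closed: "substance E C A \<Longrightarrow> causally_closed E C A"
  unfolding substance_def causally_closed_def by simp

lemma axiom_A2D: "axiom_A2 E C \<Longrightarrow> A \<subseteq> B \<Longrightarrow> B \<subseteq> E t \<Longrightarrow> C A \<subseteq> C B"
  unfolding axiom_A2_def by blast

lemma least_closed_subset_all_times:
  assumes "causal_world E C"
  shows "least_closed E C \<subseteq> E t"
proof (rule least_closed_lower)
  show "causally_closed E C (E t)"
    using causal_world.C_closed[OF assms, of t] unfolding causally_closed_def by auto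
qed

lemma least_closed_fixpoint:
  assumes world: "causal_world E C" and A2: "axiom_A2 E C"
  shows "C (least_closed E C) = least_closed E C"
proof
  let ?S = "least_closed E C"
  have "C ?S \<subseteq> A" if closed: "causally_closed E C A" for A
  proof -
    from closed obtain t where "A \<subseteq> E t" and "C A \<subseteq> A"
      unfolding causally_closed_def by blast
    moreover have "C ?S \<subseteq> C A"
      using A2 least_closed_lower[OF closed] \<open>A \<subseteq> E t\<close> by (rule axiom_A2D)
    ultimately show ?thesis by blast
  qed
  then show decreasing: "C ?S \<subseteq> ?S"
    unfolding least_closed_def by blast
  \<comment> \<open>Monotonicity makes \<open>C ?S\<close> causally closed too, so minimality gives the other inclusion.
      Any time would serve in place of \<open>0\<close>.\<close>
  have in_E: "?S \<subseteq> E 0"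
    using world by (rule least_closed_subset_all_times)
  have "C (C ?S) \<subseteq> C ?S"
    using A2 decreasing in_E by (rule axiom_A2D)
  then have "causally_closed E C (C ?S)"
    using decreasing in_E unfolding causally_closed_def by blast
  then show "?S \<subseteq> C ?S"
    by (rule least_closed_lower)
qed

theorem proposition3:
  fixes E :: "real \<Rightarrow> 'a set" and C :: "'a set \<Rightarrow> 'a set"
  assumes "causal_world E C"
    and "axiom_A1 E C"
    and "axiom_A2 E C"
  shows "\<exists>S. substance E C S \<and> S \<subseteq> (\<Inter>t. E t) \<and> S \<noteq> e_set E
           \<and> C (e_set E) \<subseteq> C S \<and> C S = S
           \<and> (\<forall>t \<Lambda>. \<Lambda> \<subseteq> E t \<and> substance E C \<Lambda> \<longrightarrow> S \<subseteq> \<Lambda>)"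
proof -
  let ?S = "least_closed E C"
  have in_E: "?S \<subseteq> E t" for t
    using assms(1) by (rule least_closed_subset_all_times)
  have fixpoint: "C ?S = ?S"
    using assms(1,3) by (rule least_closed_fixpoint)
  have "substance E C ?S"
    using in_E fixpoint unfolding substance_def by blast
  moreover have "?S \<subseteq> (\<Inter>t. E t)"
    using in_E by blast
  moreover have "?S \<noteq> e_set E"
  proof -
    have "C ?S \<noteq> {}"
      using assms(2) in_E unfolding axiom_A1_def by blast
    then show ?thesis
      by (simp add: fixpoint e_set_eq_empty)
  qed
  moreover have "C (e_set E) \<subseteq> C ?S"
    using assms(3) _ in_E by (rule axiom_A2D) (simp add: e_set_eq_empty)
  moreover have "?S \<subseteq> \<Lambda>" if "substance E C \<Lambda>" for \<Lambda>
    using that by (intro least_closed_lower substance_imp_causally_closed)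
  ultimately show ?thesis
    using fixpoint by blast
qed

end
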